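(* Let $k$ be a constant. The rotationally symmetric map $\varphi:\left(S^2\setminus\{N,S\},\frac{4(dr^2+r^2d\theta^2)}{(1+r^2)^2}\right)\longrightarrow(N^2,d\rho^2+\rho\,d\phi^2)$ with $\varphi(r,\theta)=(\rho(r),k\theta)$ is a biharmonic map if and only if $$\rho(r)=C_1+(C_2-2C_3)\ln r+C_3\ln(1+r^2)+C_4\ln r\,\ln(1+r^2)-2C_4\int\frac{\ln(1+r^2)}{r}\,dr+\frac{k^2}{4}(\ln r)^2$$ for some constants $C_1,C_2,C_3,C_4$, where $\int\cdots dr$ denotes an antiderivative. In particular, the rotationally symmetric map $\varphi:\left(S^2\setminus\{N,S\},\frac{4(dr^2+r^2d\theta^2)}{(1+r^2)^2}\right)\longrightarrow(N^2,d\rho^2+\rho\,d\phi^2)$ with $\varphi(r,\theta)=\left(\frac{k^2}{4}(\ln r)^2+\ln(1+r^2),k\theta\right)$ is a proper biharmonic map.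
   Context: For a smooth map $\phi:(M,g)\to(N,h)$ of Riemannian manifolds, $\tau(\phi)=\mathrm{Tr}_g\nabla d\phi$ is the tension field and $\tau_2(\phi)=\mathrm{Trace}_g(\nabla^\phi\nabla^\phi-\nabla^\phi_{\nabla^M})\tau(\phi)-\mathrm{Trace}_g R^N(d\phi,\tau(\phi))d\phi$ is the bitension field, with $R^N(X,Y)Z=[\nabla^N_X,\nabla^N_Y]Z-\nabla^N_{[X,Y]}Z$. The map is harmonic if $\tau(\phi)=0$, biharmonic if $\tau_2(\phi)=0$, proper biharmonic if biharmonic but not harmonic. Here $(r,\theta)$, $0<r<\infty$, are polar coordinates of the stereographic projection of the sphere minus its poles $N,S$. $N^2$ is the surface with coordinates $(\rho,\phi)$, $\rho>0$, $\phi$ angular, and metric $d\rho^2+\rho\,d\phi^2$; $\rho(r)$ is a positive smooth function. When $k$ is not an integer the statement is understood in local coordinates (locally in $\theta$). *)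

theory Defs
  imports "HOL-Analysis.Analysis"
begin

text \<open>Everything is expressed in one coordinate chart on each side: a Riemannian metric on an open
  subset of \<open>\<real>\<^sup>m\<close> is its matrix-valued coefficient function, vector fields are functions into
  \<open>\<real>\<^sup>m\<close>, and vector fields along a map \<open>\<phi>\<close> are functions of the source point with values in
  \<open>\<real>\<^sup>n\<close>. All operators below are local, so only their values on open sets matter.\<close>

primrec Ck_on :: "nat \<Rightarrow> 'a::euclidean_space set \<Rightarrow> ('a \<Rightarrow> 'b::real_normed_vector) \<Rightarrow> bool" where
  "Ck_on 0 S f \<longleftrightarrow> continuous_on S f"
| "Ck_on (Suc n) S f \<longleftrightarrow> (\<forall>x\<in>S. f differentiable (at x)) \<and>
     (\<forall>b\<in>Basis. Ck_on n S (\<lambda>x. frechet_derivative f (at x) b))"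

text \<open>Meant for open \<open>S\<close>.\<close>

definition smooth_on :: "'a::euclidean_space set \<Rightarrow> ('a \<Rightarrow> 'b::real_normed_vector) \<Rightarrow> bool" where
  "smooth_on S f \<longleftrightarrow> (\<forall>n. Ck_on n S f)"

definition coord_field :: "'m \<Rightarrow> real^'m \<Rightarrow> real^'m::finite" where
  "coord_field i = (\<lambda>x. axis i 1)"

text \<open>The \<open>a\<close>-th component is \<open>\<Gamma>\<^sup>a\<^sub>i\<^sub>j u\<^sup>i v\<^sup>j\<close> with
  \<open>\<Gamma>\<^sup>a\<^sub>i\<^sub>j = 1/2 g\<^sup>a\<^sup>l (\<partial>\<^sub>i g\<^sub>j\<^sub>l + \<partial>\<^sub>j g\<^sub>i\<^sub>l - \<partial>\<^sub>l g\<^sub>i\<^sub>j)\<close>.\<close>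

definition christoffel ::
    "(real^'m \<Rightarrow> real^'m^'m) \<Rightarrow> real^'m \<Rightarrow> real^'m \<Rightarrow> real^'m \<Rightarrow> real^'m::finite" where
  "christoffel g x u v = (\<chi> a. \<Sum>i\<in>UNIV. \<Sum>j\<in>UNIV. \<Sum>l\<in>UNIV.
     1/2 * matrix_inv (g x) $ a $ l *
     (frechet_derivative (\<lambda>y. g y $ j $ l) (at x) (axis i 1)
      + frechet_derivative (\<lambda>y. g y $ i $ l) (at x) (axis j 1)
      - frechet_derivative (\<lambda>y. g y $ i $ j) (at x) (axis l 1)) * u $ i * v $ j)"

text \<open>Levi-Civita connection \<open>\<nabla>\<^sub>X Y\<close>.\<close>

definition nabla :: "(real^'m \<Rightarrow> real^'m^'m) \<Rightarrow> (real^'m \<Rightarrow> real^'m) \<Rightarrow> (real^'m \<Rightarrow> real^'m)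
    \<Rightarrow> real^'m \<Rightarrow> real^'m::finite" where
  "nabla g X Y x = frechet_derivative Y (at x) (X x) + christoffel g x (X x) (Y x)"

definition lie_bracket ::
    "(real^'m \<Rightarrow> real^'m) \<Rightarrow> (real^'m \<Rightarrow> real^'m) \<Rightarrow> real^'m \<Rightarrow> real^'m::finite" where
  "lie_bracket X Y x = frechet_derivative Y (at x) (X x) - frechet_derivative X (at x) (Y x)"

definition curvature_field :: "(real^'m \<Rightarrow> real^'m^'m) \<Rightarrow> (real^'m \<Rightarrow> real^'m) \<Rightarrow>
    (real^'m \<Rightarrow> real^'m) \<Rightarrow> (real^'m \<Rightarrow> real^'m) \<Rightarrow> real^'m \<Rightarrow> real^'m::finite" where
  "curvature_field h X Y Z x =
     nabla h X (nabla h Y Z) x - nabla h Y (nabla h X Z) x - nabla h (lie_bracket X Y) Z x"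

text \<open>Curvature is tensorial, so its value on tangent vectors at \<open>y\<close> may be computed by extending
  them to vector fields with constant coefficients.\<close>

definition curvature ::
    "(real^'m \<Rightarrow> real^'m^'m) \<Rightarrow> real^'m \<Rightarrow> real^'m \<Rightarrow> real^'m \<Rightarrow> real^'m \<Rightarrow> real^'m::finite" where
  "curvature h y u v w = curvature_field h (\<lambda>_. u) (\<lambda>_. v) (\<lambda>_. w) y"

definition differential ::
    "(real^'m \<Rightarrow> real^'n) \<Rightarrow> (real^'m \<Rightarrow> real^'m) \<Rightarrow> real^'m::finite \<Rightarrow> real^'n::finite" where
  "differential \<phi> X x = frechet_derivative \<phi> (at x) (X x)"

text \<open>Pull-back connection \<open>\<nabla>\<^sup>\<phi>\<^sub>X V\<close> on vector fields \<open>V\<close> along \<open>\<phi>\<close>.\<close>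

definition nabla_along :: "(real^'n \<Rightarrow> real^'n^'n) \<Rightarrow> (real^'m \<Rightarrow> real^'n) \<Rightarrow>
    (real^'m \<Rightarrow> real^'m) \<Rightarrow> (real^'m \<Rightarrow> real^'n) \<Rightarrow> real^'m::finite \<Rightarrow> real^'n::finite" where
  "nabla_along h \<phi> X V x =
     frechet_derivative V (at x) (X x) + christoffel h (\<phi> x) (differential \<phi> X x) (V x)"

text \<open>The trace with respect to \<open>g\<close> is taken in the coordinate frame, i.e. by contracting with
  \<open>g\<^sup>i\<^sup>j\<close>.\<close>

definition metric_trace :: "(real^'m \<Rightarrow> real^'m^'m) \<Rightarrow>
    ((real^'m \<Rightarrow> real^'m) \<Rightarrow> (real^'m \<Rightarrow> real^'m) \<Rightarrow> real^'m \<Rightarrow> real^'n) \<Rightarrow>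
    real^'m::finite \<Rightarrow> real^'n::finite" where
  "metric_trace g B x = (\<Sum>i\<in>UNIV. \<Sum>j\<in>UNIV.
     matrix_inv (g x) $ i $ j *\<^sub>R B (coord_field i) (coord_field j) x)"

definition tension_field :: "(real^'m \<Rightarrow> real^'m^'m) \<Rightarrow> (real^'n \<Rightarrow> real^'n^'n) \<Rightarrow>
    (real^'m \<Rightarrow> real^'n) \<Rightarrow> real^'m::finite \<Rightarrow> real^'n::finite" where
  "tension_field g h \<phi> = metric_trace g (\<lambda>X Y x.
     nabla_along h \<phi> X (differential \<phi> Y) x - differential \<phi> (nabla g X Y) x)"

definition bitension_field :: "(real^'m \<Rightarrow> real^'m^'m) \<Rightarrow> (real^'n \<Rightarrow> real^'n^'n) \<Rightarrow>
    (real^'m \<Rightarrow> real^'n) \<Rightarrow> real^'m::finite \<Rightarrow> real^'n::finite" where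
  "bitension_field g h \<phi> x =
     metric_trace g (\<lambda>X Y x.
       nabla_along h \<phi> X (nabla_along h \<phi> Y (tension_field g h \<phi>)) x
       - nabla_along h \<phi> (nabla g X Y) (tension_field g h \<phi>) x) x
     - metric_trace g (\<lambda>X Y x.
         curvature h (\<phi> x) (differential \<phi> X x) (tension_field g h \<phi> x) (differential \<phi> Y x)) x"

definition smooth_map ::
    "(real^'m) set \<Rightarrow> (real^'n) set \<Rightarrow> (real^'m::finite \<Rightarrow> real^'n::finite) \<Rightarrow> bool" where
  "smooth_map U V \<phi> \<longleftrightarrow> smooth_on U \<phi> \<and> \<phi> ` U \<subseteq> V"

definition harmonic_map :: "(real^'m) set \<Rightarrow> (real^'m \<Rightarrow> real^'m^'m) \<Rightarrow>
    (real^'n) set \<Rightarrow> (real^'n \<Rightarrow> real^'n^'n) \<Rightarrow> (real^'m::finite \<Rightarrow> real^'n::finite) \<Rightarrow> bool" where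
  "harmonic_map U g V h \<phi> \<longleftrightarrow> smooth_map U V \<phi> \<and> (\<forall>x\<in>U. tension_field g h \<phi> x = 0)"

definition biharmonic_map :: "(real^'m) set \<Rightarrow> (real^'m \<Rightarrow> real^'m^'m) \<Rightarrow>
    (real^'n) set \<Rightarrow> (real^'n \<Rightarrow> real^'n^'n) \<Rightarrow> (real^'m::finite \<Rightarrow> real^'n::finite) \<Rightarrow> bool" where
  "biharmonic_map U g V h \<phi> \<longleftrightarrow> smooth_map U V \<phi> \<and> (\<forall>x\<in>U. bitension_field g h \<phi> x = 0)"

definition proper_biharmonic_map :: "(real^'m) set \<Rightarrow> (real^'m \<Rightarrow> real^'m^'m) \<Rightarrow>
    (real^'n) set \<Rightarrow> (real^'n \<Rightarrow> real^'n^'n) \<Rightarrow> (real^'m::finite \<Rightarrow> real^'n::finite) \<Rightarrow> bool" where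
  "proper_biharmonic_map U g V h \<phi> \<longleftrightarrow> biharmonic_map U g V h \<phi> \<and> \<not> harmonic_map U g V h \<phi>"

text \<open>The coordinates on the twice punctured sphere are \<open>(r, \<theta>) = (x $ 1, x $ 2)\<close>, with the angle
  \<open>\<theta>\<close> ranging over a set \<open>\<Theta>\<close> of reals: an interval of length at most \<open>2\<pi>\<close> gives an honest chart (a
  sector), and \<open>\<Theta> = UNIV\<close> gives the universal cover.\<close>

definition punctured_sphere :: "real set \<Rightarrow> (real^2) set" where
  "punctured_sphere \<Theta> = {x. 0 < x $ 1 \<and> x $ 2 \<in> \<Theta>}"

definition sphere_metric :: "real^2 \<Rightarrow> real^2^2" where
  "sphere_metric x = (let r = x $ 1 in
     vector [vector [4 / (1 + r\<^sup>2)\<^sup>2, 0],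
             vector [0, 4 * r\<^sup>2 / (1 + r\<^sup>2)\<^sup>2]])"

text \<open>The surface with metric \<open>d\<rho>\<^sup>2 + \<rho> d\<phi>\<^sup>2\<close>, coordinates \<open>(\<rho>, \<phi>) = (y $ 1, y $ 2)\<close>; the angular
  coordinate is lifted to the real line.\<close>

definition target_surface :: "(real^2) set" where
  "target_surface = {y. 0 < y $ 1}"

definition target_metric :: "real^2 \<Rightarrow> real^2^2" where
  "target_metric y = vector [vector [1, 0], vector [0, y $ 1]]"

definition rot_map :: "(real \<Rightarrow> real) \<Rightarrow> real \<Rightarrow> real^2 \<Rightarrow> real^2" where
  "rot_map \<rho> k x = vector [\<rho> (x $ 1), k * x $ 2]"

end

theory Submission
  imports Defs
begin

text \<open>
  In the variable \<open>s = ln r\<close> the sphere metric is \<open>\<lambda> (ds\<^sup>2 + d\<theta>\<^sup>2)\<close> with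
  \<open>\<lambda> = 4 r\<^sup>2 / (1 + r\<^sup>2)\<^sup>2\<close>, that is, conformally flat. For a radial profile \<open>\<rho>\<close> the tension
  field is therefore purely radial, with component
  \<open>T = (\<rho>\<^sub>s\<^sub>s - k\<^sup>2/2) / \<lambda>\<close>: the target \<open>d\<rho>\<^sup>2 + \<rho> d\<phi>\<^sup>2\<close> contributes \<open>k\<^sup>2\<close> times half the
  \<open>\<rho>\<close>-derivative of its coefficient \<open>\<rho>\<close>, which is constant. For the same reason the bitension field is
  free of a zeroth-order term in \<open>T\<close>: the rough
  Laplacian of \<open>T \<partial>\<^sub>\<rho>\<close> produces \<open>- k\<^sup>2 T / (4 \<rho> \<lambda>)\<close>, and the curvature of the target,
  \<open>K = 1 / (4 \<rho>\<^sup>2)\<close>, produces exactly the opposite term. Hence the bitension field is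
  \<open>T\<^sub>s\<^sub>s / \<lambda>\<close> in the radial direction
  (\<open>tension_field_rot_map\<close>, \<open>bitension_field_rot_map\<close>).

  So the map is biharmonic exactly when \<open>T\<close> is an affine function \<open>C\<^sub>3 + C\<^sub>4 ln r\<close> of \<open>s\<close>
  (\<open>radial_tension_log_iff\<close>), and it remains to solve
  \<open>\<rho>\<^sub>s\<^sub>s = k\<^sup>2/2 + \<lambda> (C\<^sub>3 + C\<^sub>4 s)\<close>. Since \<open>\<lambda>\<close> is the second \<open>s\<close>-derivative of \<open>ln (1 + r\<^sup>2)\<close>,
  integrating twice gives the stated family
  (\<open>radial_tension_biharmonic_profile\<close>, \<open>biharmonic_profile_if_radial_tension_log\<close>).
  The profile \<open>k\<^sup>2/4 (ln r)\<^sup>2 + ln (1 + r\<^sup>2)\<close> is the member with \<open>T = 1\<close>, which makes it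
  biharmonic and not harmonic.

  The calculations are carried out in the coordinate \<open>r\<close>, where \<open>r\<^sup>-\<^sup>2 \<partial>\<^sub>s\<^sup>2\<close> becomes the operator
  \<open>u'' + u' / r\<close>.
\<close>

section \<open>Calculus of smooth functions\<close>

lemma frechet_derivative_eqI:
  "(f has_derivative D) (at x) \<Longrightarrow> frechet_derivative f (at x) = D"
  using frechet_derivative_at by metis

lemma has_derivative_cong_open:
  assumes "open S" "x \<in> S" "\<And>y. y \<in> S \<Longrightarrow> f y = g y"
  shows "(f has_derivative D) (at x) = (g has_derivative D) (at x)"
  using has_derivative_transform_within_open[OF _ assms(1,2), of f D UNIV g]
    has_derivative_transform_within_open[OF _ assms(1,2), of g D UNIV f] assms(3) by auto

lemma frechet_derivative_cong_open:
  assumes "open S" "x \<in> S" "\<And>y. y \<in> S \<Longrightarrow> f y = g y"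
  shows "frechet_derivative f (at x) = frechet_derivative g (at x)"
  unfolding frechet_derivative_def using has_derivative_cong_open[OF assms] by simp

lemma Ck_on_cong:
  assumes "open S" "\<And>y. y \<in> S \<Longrightarrow> f y = g y"
  shows "Ck_on n S f = Ck_on n S g"
  using assms(2)
proof (induction n arbitrary: f g)
  case 0
  then show ?case by (simp cong: continuous_on_cong)
next
  case (Suc n)
  have d: "f differentiable (at x) \<longleftrightarrow> g differentiable (at x)" if "x \<in> S" for x
    unfolding differentiable_def using has_derivative_cong_open[OF assms(1) that Suc.prems] by simp
  have "Ck_on n S (\<lambda>x. frechet_derivative f (at x) b) = Ck_on n S (\<lambda>x. frechet_derivative g (at x) b)"
    for b
    by (rule Suc.IH) (use frechet_derivative_cong_open[OF assms(1)] Suc.prems in metis)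
  then show ?case using d by simp
qed

text \<open>The recursion for differentiability classes speaks of the chosen derivative at every point;
  this form accepts any derivative that is known on \<open>S\<close> alone, which is what all the closure
  properties below are checked with.\<close>

lemma Ck_on_SucI:
  assumes "open S" "\<And>x. x \<in> S \<Longrightarrow> (f has_derivative D x) (at x)"
    "\<And>b. b \<in> Basis \<Longrightarrow> Ck_on n S (\<lambda>x. D x b)"
  shows "Ck_on (Suc n) S f"
proof -
  have "Ck_on n S (\<lambda>x. frechet_derivative f (at x) b) = Ck_on n S (\<lambda>x. D x b)" for b
    by (rule Ck_on_cong[OF assms(1)]) (simp add: frechet_derivative_eqI[OF assms(2)])
  with assms show ?thesis by (auto simp: differentiable_def)
qed

lemma Ck_on_Suc_realI:
  fixes f :: "real \<Rightarrow> real"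
  assumes "open S" "\<And>x. x \<in> S \<Longrightarrow> (f has_real_derivative f' x) (at x)" "Ck_on n S f'"
  shows "Ck_on (Suc n) S f"
  by (rule Ck_on_SucI[where D = "\<lambda>x h. f' x * h", OF assms(1)])
    (use assms in \<open>auto simp: has_field_derivative_def\<close>)

lemma Ck_on_Suc_realD:
  fixes f :: "real \<Rightarrow> real"
  assumes "open S" "Ck_on (Suc n) S f"
  shows "x \<in> S \<Longrightarrow> (f has_real_derivative deriv f x) (at x)" and "Ck_on n S (deriv f)"
proof -
  have d: "(f has_real_derivative deriv f x) (at x)" if "x \<in> S" for x
    using assms that by (auto simp: DERIV_deriv_iff_real_differentiable)
  then show "x \<in> S \<Longrightarrow> (f has_real_derivative deriv f x) (at x)" .
  have "Ck_on n S (\<lambda>x. frechet_derivative f (at x) 1) = Ck_on n S (deriv f)"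
    by (rule Ck_on_cong[OF assms(1)])
      (simp add: frechet_derivative_eqI[OF d[unfolded has_field_derivative_def]])
  then show "Ck_on n S (deriv f)" using assms by simp
qed

lemma Ck_on_Suc_imp:
  fixes f :: "real \<Rightarrow> real"
  assumes "open S" "Ck_on (Suc n) S f"
  shows "Ck_on n S f"
  using assms(2)
proof (induction n arbitrary: f)
  case 0
  then show ?case
    using differentiable_at_imp_differentiable_on differentiable_imp_continuous_on
    by (metis Ck_on.simps)
next
  case (Suc n)
  show ?case
    by (rule Ck_on_Suc_realI[OF assms(1) Ck_on_Suc_realD(1)[OF assms(1) Suc.prems]])
      (auto intro!: Suc.IH Ck_on_Suc_realD(2)[OF assms(1) Suc.prems])
qed

lemma Ck_on_const: "Ck_on n S (\<lambda>x. c)"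
  by (induction n arbitrary: c) auto

lemma Ck_on_add:
  assumes "open S" "Ck_on n S f" "Ck_on n S g"
  shows "Ck_on n S (\<lambda>x. f x + g x)"
  using assms(2,3)
proof (induction n arbitrary: f g)
  case 0
  then show ?case by (simp add: continuous_on_add)
next
  case (Suc n)
  show ?case
  proof (rule Ck_on_SucI[OF assms(1)])
    show "((\<lambda>x. f x + g x) has_derivative
        (\<lambda>h. frechet_derivative f (at x) h + frechet_derivative g (at x) h)) (at x)" if "x \<in> S" for x
      using Suc.prems that
      by (auto intro!: has_derivative_add simp: frechet_derivative_works[symmetric])
  qed (use Suc in auto)
qed

lemma Ck_on_mult:
  fixes f g :: "real \<Rightarrow> real"
  assumes "open S" "Ck_on n S f" "Ck_on n S g"
  shows "Ck_on n S (\<lambda>x. f x * g x)"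
  using assms(2,3)
proof (induction n arbitrary: f g)
  case 0
  then show ?case by (simp add: continuous_on_mult)
next
  case (Suc n)
  note d = Ck_on_Suc_realD[OF assms(1)] and w = Ck_on_Suc_imp[OF assms(1)]
  show ?case
  proof (rule Ck_on_Suc_realI[OF assms(1)])
    show "((\<lambda>x. f x * g x) has_real_derivative deriv f x * g x + f x * deriv g x) (at x)"
      if "x \<in> S" for x
      using DERIV_mult[OF d(1)[OF Suc.prems(1) that] d(1)[OF Suc.prems(2) that]]
      by (simp add: mult.commute)
    show "Ck_on n S (\<lambda>x. deriv f x * g x + f x * deriv g x)"
      by (intro Ck_on_add assms(1) Suc.IH d(2)[OF Suc.prems(1)] d(2)[OF Suc.prems(2)]
          w[OF Suc.prems(1)] w[OF Suc.prems(2)])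
  qed
qed

lemma Ck_on_inverse:
  fixes f :: "real \<Rightarrow> real"
  assumes "open S" "Ck_on n S f" "\<And>x. x \<in> S \<Longrightarrow> f x \<noteq> 0"
  shows "Ck_on n S (\<lambda>x. inverse (f x))"
  using assms(2)
proof (induction n)
  case 0
  then show ?case using assms(3) by (auto intro!: continuous_on_inverse)
next
  case (Suc n)
  have w: "Ck_on n S (\<lambda>x. inverse (f x))"
    by (rule Suc.IH[OF Ck_on_Suc_imp[OF assms(1) Suc.prems]])
  show ?case
  proof (rule Ck_on_Suc_realI[OF assms(1)])
    show "((\<lambda>x. inverse (f x)) has_real_derivative
        (-1) * (deriv f x * (inverse (f x) * inverse (f x)))) (at x)" if "x \<in> S" for x
      using DERIV_inverse'[OF Ck_on_Suc_realD(1)[OF assms(1) Suc.prems that] assms(3)[OF that]]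
      by (simp add: mult_ac)
    show "Ck_on n S (\<lambda>x. (-1) * (deriv f x * (inverse (f x) * inverse (f x))))"
      by (intro Ck_on_mult Ck_on_const assms(1) w Ck_on_Suc_realD(2)[OF assms(1) Suc.prems])
  qed
qed

lemma Ck_on_ident: "open S \<Longrightarrow> Ck_on n S (\<lambda>x::real. x)"
  by (cases n) (auto intro!: Ck_on_Suc_realI[where f' = "\<lambda>_. 1"] Ck_on_const
      derivative_eq_intros simp del: Ck_on.simps(2))

lemma Ck_on_ln:
  fixes f :: "real \<Rightarrow> real"
  assumes "open S" "Ck_on (Suc n) S f" "\<And>x. x \<in> S \<Longrightarrow> f x > 0"
  shows "Ck_on (Suc n) S (\<lambda>x. ln (f x))"
proof (rule Ck_on_Suc_realI[OF assms(1)])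
  show "((\<lambda>x. ln (f x)) has_real_derivative inverse (f x) * deriv f x) (at x)" if "x \<in> S" for x
    using DERIV_chain2[OF DERIV_ln[OF assms(3)[OF that]] Ck_on_Suc_realD(1)[OF assms(1,2) that]] .
  show "Ck_on n S (\<lambda>x. inverse (f x) * deriv f x)"
    by (intro Ck_on_mult Ck_on_inverse Ck_on_Suc_realD(2)[OF assms(1,2)]
        Ck_on_Suc_imp[OF assms(1,2)] assms(1)) (use assms(3) in force)
qed

lemma smooth_on_deriv:
  fixes f :: "real \<Rightarrow> real"
  assumes "open S" "smooth_on S f"
  shows "x \<in> S \<Longrightarrow> (f has_real_derivative deriv f x) (at x)" and "smooth_on S (deriv f)"
  using Ck_on_Suc_realD[OF assms(1), of _ f] assms(2) unfolding smooth_on_def by blast+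

lemma smooth_on_ln_ln1p:
  "smooth_on {0<..} (\<lambda>r::real. c * (ln r)\<^sup>2 + ln (1 + r\<^sup>2))"
proof -
  have "Ck_on (Suc n) {0<..} (\<lambda>r::real. c * (ln r * ln r) + ln (1 + r * r))" for n
    by (intro Ck_on_add Ck_on_mult Ck_on_ln Ck_on_ident Ck_on_const) (auto intro: add_pos_pos)
  then have "Ck_on n {0<..} (\<lambda>r::real. c * (ln r)\<^sup>2 + ln (1 + r\<^sup>2))" for n
    using Ck_on_Suc_imp[OF open_greaterThan] unfolding power2_eq_square by metis
  then show ?thesis by (simp add: smooth_on_def)
qed

section \<open>Maps of the plane depending on one coordinate\<close>

lemma vector_2_eq: "(vector [a, b] :: real^2) = a *\<^sub>R axis 1 1 + b *\<^sub>R axis 2 1"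
  by (simp add: vec_eq_iff forall_2 axis_def)

lemma vector_2_eq_iff: "(vector [a, b] :: real^2) = vector [c, d] \<longleftrightarrow> a = c \<and> b = d"
  by (simp add: vec_eq_iff forall_2)

lemma vector_2_arith:
  "(vector [a, b] :: real^2) + vector [c, d] = vector [a + c, b + d]"
  "(vector [a, b] :: real^2) - vector [c, d] = vector [a - c, b - d]"
  "t *\<^sub>R (vector [a, b] :: real^2) = vector [t * a, t * b]"
  "(0 :: real^2) = vector [0, 0]"
  by (simp_all add: vec_eq_iff forall_2)

lemma has_derivative_vector_2:
  assumes "(f has_derivative f') F" "(g has_derivative g') F"
  shows "((\<lambda>x. vector [f x, g x] :: real^2) has_derivative (\<lambda>h. vector [f' h, g' h])) F"
  unfolding vector_2_eq using assms by (auto intro!: derivative_intros)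

lemma has_derivative_nth: "((\<lambda>x::real^2. x $ i) has_derivative (\<lambda>h. h $ i)) F"
  by (rule bounded_linear_imp_has_derivative) (rule bounded_linear_vec_nth)

lemma has_derivative_of_first:
  assumes "(f has_real_derivative f') (at (x $ 1))"
  shows "((\<lambda>y::real^2. f (y $ 1)) has_derivative (\<lambda>h. f' * h $ 1)) (at x)"
  using has_derivative_compose[OF has_derivative_nth assms[unfolded has_field_derivative_def]]
  by simp

lemma open_half_plane: "open {x::real^2. 0 < x $ 1}"
  by (rule open_Collect_less) (auto intro: continuous_intros)

text \<open>The vector \<open>c\<close> varies in the induction, because a partial derivative multiplies it by a
  constant.\<close>

lemma Ck_on_of_first:
  fixes f :: "real \<Rightarrow> real" and c :: "real^2"
  assumes "Ck_on n {0<..} f"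
  shows "Ck_on n {x::real^2. 0 < x $ 1} (\<lambda>x. f (x $ 1) *\<^sub>R c)"
  using assms
proof (induction n arbitrary: f c)
  case 0
  then show ?case
    by (auto intro!: continuous_intros intro: continuous_on_compose2[of "{0<..}" f])
next
  case (Suc n)
  note d = Ck_on_Suc_realD[OF open_greaterThan Suc.prems]
  show ?case
  proof (rule Ck_on_SucI[OF open_half_plane])
    show "((\<lambda>x. f (x $ 1) *\<^sub>R c) has_derivative (\<lambda>h. (deriv f (x $ 1) * h $ 1) *\<^sub>R c)) (at x)"
      if "x \<in> {x. 0 < x $ 1}" for x :: "real^2"
      using that by (intro has_derivative_scaleR_left has_derivative_of_first d(1)) auto
    show "Ck_on n {x. 0 < x $ 1} (\<lambda>x::real^2. (deriv f (x $ 1) * b $ 1) *\<^sub>R c)" for b :: "real^2"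
      using Suc.IH[OF d(2), of "b $ 1 *\<^sub>R c"] by simp
  qed
qed

lemma Ck_on_subset:
  assumes "Ck_on n S f" "T \<subseteq> S"
  shows "Ck_on n T f"
  using assms(1)
proof (induction n arbitrary: f)
  case 0
  then show ?case using assms(2) continuous_on_subset by auto
qed (use assms(2) in auto)

lemma Ck_on_second_linear: "open S \<Longrightarrow> Ck_on n S (\<lambda>x::real^2. (k * x $ 2) *\<^sub>R (c::real^2))"
proof (cases n)
  case (Suc m)
  assume "open S"
  then show ?thesis
    unfolding Suc
    by (rule Ck_on_SucI[where D = "\<lambda>x h. (k * h $ 2) *\<^sub>R c"])
      (auto intro!: derivative_intros has_derivative_nth Ck_on_const)
qed (auto intro!: continuous_intros)

lemma smooth_rot_map:
  assumes "smooth_on {0<..} \<rho>"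
  shows "smooth_on {x::real^2. 0 < x $ 1} (rot_map \<rho> k)"
proof -
  have "Ck_on n {x::real^2. 0 < x $ 1} (\<lambda>x. \<rho> (x $ 1) *\<^sub>R axis 1 1 + (k * x $ 2) *\<^sub>R axis 2 1 :: real^2)" for n
    using assms unfolding smooth_on_def
    by (intro Ck_on_add Ck_on_of_first Ck_on_second_linear open_half_plane) auto
  then show ?thesis
    by (simp add: smooth_on_def rot_map_def[abs_def] vector_2_eq)
qed

section \<open>The two metrics\<close>

text \<open>Both metrics are diagonal with coefficients depending on the first coordinate only, so a single
  computation of the Christoffel symbols serves for both.\<close>

definition diagonal_metric :: "(real \<Rightarrow> real) \<Rightarrow> (real \<Rightarrow> real) \<Rightarrow> real^2 \<Rightarrow> real^2^2" where
  "diagonal_metric E G x = vector [vector [E (x $ 1), 0], vector [0, G (x $ 1)]]"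

lemma matrix_inv_diagonal:
  fixes a b :: real
  assumes "a \<noteq> 0" "b \<noteq> 0"
  shows "matrix_inv (vector [vector [a, 0], vector [0, b]] :: real^2^2) =
    vector [vector [1/a, 0], vector [0, 1/b]]"
proof -
  let ?A = "vector [vector [a, 0], vector [0, b]] :: real^2^2"
  let ?B = "vector [vector [1/a, 0], vector [0, 1/b]] :: real^2^2"
  have AB: "?A ** ?B = mat 1" "?B ** ?A = mat 1"
    using assms by (simp_all add: matrix_matrix_mult_def vec_eq_iff forall_2 sum_2 mat_def)
  have "?A ** matrix_inv ?A = mat 1"
    unfolding matrix_inv_def by (rule someI2[of _ ?B]) (use AB in auto)
  then have "?B ** (?A ** matrix_inv ?A) = ?B" by simp
  then show ?thesis by (simp add: matrix_mul_assoc AB(2))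
qed

lemma christoffel_diagonal_metric:
  assumes "(E has_real_derivative E') (at (x $ 1))" "(G has_real_derivative G') (at (x $ 1))"
    and "E (x $ 1) \<noteq> 0" "G (x $ 1) \<noteq> 0"
  shows "christoffel (diagonal_metric E G) x u v = vector
    [(E' * u $ 1 * v $ 1 - G' * u $ 2 * v $ 2) / (2 * E (x $ 1)),
     G' * (u $ 1 * v $ 2 + u $ 2 * v $ 1) / (2 * G (x $ 1))]"
proof -
  have E: "frechet_derivative (\<lambda>y::real^2. E (y $ 1)) (at x) = (\<lambda>h. E' * h $ 1)"
    and G: "frechet_derivative (\<lambda>y::real^2. G (y $ 1)) (at x) = (\<lambda>h. G' * h $ 1)"
    by (intro frechet_derivative_eqI has_derivative_of_first assms)+
  have 0: "frechet_derivative (\<lambda>y::real^2. 0::real) (at x) = (\<lambda>h. 0)"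
    by (intro frechet_derivative_eqI) simp
  show ?thesis
    using assms(3,4)
    unfolding christoffel_def diagonal_metric_def
    by (simp add: matrix_inv_diagonal vec_eq_iff forall_2 sum_2 axis_def E G 0)
      (simp add: field_simps)
qed

lemma target_metric_eq: "target_metric = diagonal_metric (\<lambda>_. 1) (\<lambda>\<rho>. \<rho>)"
  by (simp add: fun_eq_iff target_metric_def diagonal_metric_def)

lemma sphere_metric_eq:
  "sphere_metric = diagonal_metric (\<lambda>r. 4 / (1 + r\<^sup>2)\<^sup>2) (\<lambda>r. 4 * r\<^sup>2 / (1 + r\<^sup>2)\<^sup>2)"
  by (simp add: fun_eq_iff sphere_metric_def diagonal_metric_def Let_def)

lemma one_plus_square_nonzero: "1 + r\<^sup>2 \<noteq> (0::real)"
  by (metis sum_power2_eq_zero_iff one_power2 zero_neq_one)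

lemma metric_trace_sphere:
  assumes "0 < x $ 1"
  shows "metric_trace sphere_metric B x = ((1 + (x $ 1)\<^sup>2)\<^sup>2 / 4) *\<^sub>R
    (B (coord_field 1) (coord_field 1) x + (1 / (x $ 1)\<^sup>2) *\<^sub>R B (coord_field 2) (coord_field 2) x)"
  using assms one_plus_square_nonzero[of "x $ 1"]
  by (simp add: metric_trace_def sphere_metric_def Let_def sum_2 matrix_inv_diagonal scaleR_right_distrib)

lemma christoffel_target:
  assumes "0 < y $ 1"
  shows "christoffel target_metric y u v =
    vector [- (u $ 2 * v $ 2) / 2, (u $ 1 * v $ 2 + u $ 2 * v $ 1) / (2 * y $ 1)]"
  unfolding target_metric_eq
  by (subst christoffel_diagonal_metric[where E' = 0 and G' = 1]) (use assms in auto)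

lemma nabla_sphere_coord:
  fixes x :: "real^2"
  assumes "0 < x $ 1"
  defines "r \<equiv> x $ 1"
  shows "nabla sphere_metric (coord_field 1) (coord_field 1) x = vector [- 2 * r / (1 + r\<^sup>2), 0]"
    and "nabla sphere_metric (coord_field 2) (coord_field 2) x =
      vector [- r * (1 - r\<^sup>2) / (1 + r\<^sup>2), 0]"
proof -
  note nz = one_plus_square_nonzero[of r]
  have E: "((\<lambda>r. 4 / (1 + r\<^sup>2)\<^sup>2) has_real_derivative - 16 * r / (1 + r\<^sup>2)^3) (at r)"
    using nz by (auto intro!: derivative_eq_intros simp: divide_simps) algebra
  have G: "((\<lambda>r. 4 * r\<^sup>2 / (1 + r\<^sup>2)\<^sup>2) has_real_derivative
      8 * r * (1 - r\<^sup>2) / (1 + r\<^sup>2)^3) (at r)"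
    using nz by (auto intro!: derivative_eq_intros simp: divide_simps) algebra
  have nabla: "nabla g (coord_field i) (coord_field i) x = christoffel g x (axis i 1) (axis i 1)"
    for g and i :: 2
    by (simp add: nabla_def coord_field_def frechet_derivative_const)
  have c: "christoffel sphere_metric x u v = vector
    [(- 16 * r / (1 + r\<^sup>2)^3 * u $ 1 * v $ 1 - 8 * r * (1 - r\<^sup>2) / (1 + r\<^sup>2)^3 * u $ 2 * v $ 2)
        / (2 * (4 / (1 + r\<^sup>2)\<^sup>2)),
     8 * r * (1 - r\<^sup>2) / (1 + r\<^sup>2)^3 * (u $ 1 * v $ 2 + u $ 2 * v $ 1)
        / (2 * (4 * r\<^sup>2 / (1 + r\<^sup>2)\<^sup>2))]" for u v
    unfolding sphere_metric_eq r_def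
    by (rule christoffel_diagonal_metric)
      (use E G nz assms(1) in \<open>auto simp: r_def\<close>)
  show "nabla sphere_metric (coord_field 1) (coord_field 1) x = vector [- 2 * r / (1 + r\<^sup>2), 0]"
    "nabla sphere_metric (coord_field 2) (coord_field 2) x =
      vector [- r * (1 - r\<^sup>2) / (1 + r\<^sup>2), 0]"
    unfolding nabla c vector_2_eq_iff using nz
    by (simp_all add: axis_def divide_simps) algebra+
qed

text \<open>On a surface the curvature tensor is \<open>K (\<langle>v, w\<rangle> u - \<langle>u, w\<rangle> v)\<close>. Here \<open>K = - \<sigma>'' / \<sigma>\<close> for the
  warping function \<open>\<sigma> = \<surd>\<rho>\<close>, which gives \<open>K = 1 / (4 \<rho>\<^sup>2)\<close>.\<close>

lemma curvature_target:
  fixes y u v w :: "real^2"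
  assumes "0 < y $ 1"
  shows "curvature target_metric y u v w = (1 / (4 * (y $ 1)\<^sup>2)) *\<^sub>R
    ((v $ 1 * w $ 1 + y $ 1 * (v $ 2 * w $ 2)) *\<^sub>R u - (u $ 1 * w $ 1 + y $ 1 * (u $ 2 * w $ 2)) *\<^sub>R v)"
proof -
  have const: "frechet_derivative (\<lambda>_. c :: real^2) (at z) = (\<lambda>h. 0)" for c and z :: "real^2"
    by (simp add: frechet_derivative_const)
  have nabla: "nabla target_metric (\<lambda>_. a) (\<lambda>_. b) z =
      vector [- (a $ 2 * b $ 2) / 2, (a $ 1 * b $ 2 + a $ 2 * b $ 1) / 2 * inverse (z $ 1)]"
    if "0 < z $ 1" for a b z
    using that by (simp add: nabla_def const christoffel_target field_simps vector_2_eq_iff)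
  have inv: "((\<lambda>t. inverse t) has_real_derivative - 1 / (y $ 1)\<^sup>2) (at (y $ 1))"
    using assms by (auto intro!: derivative_eq_intros simp: power2_eq_square field_simps)
  have D: "frechet_derivative (nabla target_metric (\<lambda>_. a) (\<lambda>_. b)) (at y) =
      (\<lambda>h. vector [0, (a $ 1 * b $ 2 + a $ 2 * b $ 1) / 2 * (- 1 / (y $ 1)\<^sup>2 * h $ 1)])" for a b
  proof -
    have "frechet_derivative (nabla target_metric (\<lambda>_. a) (\<lambda>_. b)) (at y) =
        frechet_derivative (\<lambda>z::real^2. vector [- (a $ 2 * b $ 2) / 2,
          (a $ 1 * b $ 2 + a $ 2 * b $ 1) / 2 * inverse (z $ 1)] :: real^2) (at y)"
      by (rule frechet_derivative_cong_open[OF open_half_plane]) (use assms nabla in auto)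
    also have "\<dots> = (\<lambda>h. vector [0, (a $ 1 * b $ 2 + a $ 2 * b $ 1) / 2 * (- 1 / (y $ 1)\<^sup>2 * h $ 1)])"
      by (intro frechet_derivative_eqI has_derivative_vector_2 has_derivative_const
          has_derivative_mult_right has_derivative_of_first[OF inv])
    finally show ?thesis .
  qed
  have outer: "nabla target_metric (\<lambda>_. a) (nabla target_metric (\<lambda>_. b) (\<lambda>_. c)) y =
      vector [0, (b $ 1 * c $ 2 + b $ 2 * c $ 1) / 2 * (- 1 / (y $ 1)\<^sup>2 * a $ 1)] +
      christoffel target_metric y a (nabla target_metric (\<lambda>_. b) (\<lambda>_. c) y)" for a b c
    by (subst nabla_def) (simp add: D)
  have bracket: "nabla target_metric (lie_bracket (\<lambda>_. u) (\<lambda>_. v)) (\<lambda>_. w) y = 0"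
    using assms
    by (simp add: nabla_def const lie_bracket_def christoffel_target vec_eq_iff forall_2)
  show ?thesis
    using assms
    unfolding curvature_def curvature_field_def outer bracket nabla[OF assms]
      christoffel_target[OF assms]
    by (simp add: vec_eq_iff forall_2 field_simps power2_eq_square)
qed

section \<open>Rotationally symmetric fields along the map\<close>

definition rotational_field :: "(real \<Rightarrow> real) \<Rightarrow> (real \<Rightarrow> real) \<Rightarrow> real^2 \<Rightarrow> real^2" where
  "rotational_field a b x = vector [a (x $ 1), b (x $ 1)]"

lemma differential_rot_map:
  assumes "(\<rho> has_real_derivative \<rho>') (at (x $ 1))"
  shows "differential (rot_map \<rho> k) X x = vector [\<rho>' * X x $ 1, k * X x $ 2]"
proof -
  have "(rot_map \<rho> k has_derivative (\<lambda>h. vector [\<rho>' * h $ 1, k * h $ 2])) (at x)"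
    unfolding rot_map_def[abs_def]
    by (intro has_derivative_vector_2 has_derivative_of_first assms has_derivative_mult_right
        has_derivative_nth)
  then show ?thesis
    by (simp add: differential_def frechet_derivative_eqI)
qed

text \<open>The coordinate derivatives of the map, its tension field and the covariant derivatives of these
  are all fields with components depending only on \<open>r\<close>, so this formula, applied twice,
  gives every second covariant derivative in the bitension field. The hypothesis on \<open>V\<close> covers only
  \<open>r > 0\<close>, since the fields have this shape only there.\<close>

lemma nabla_along_rotational_field:
  assumes "\<And>y. 0 < y $ 1 \<Longrightarrow> V y = rotational_field a b y" and "0 < x $ 1"
    and "(a has_real_derivative a') (at (x $ 1))" "(b has_real_derivative b') (at (x $ 1))"
    and "(\<rho> has_real_derivative \<rho>') (at (x $ 1))" and pos: "0 < \<rho> (x $ 1)"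
  shows "nabla_along target_metric (rot_map \<rho> k) X V x = vector
    [a' * X x $ 1 - k * b (x $ 1) / 2 * X x $ 2,
     (b' + \<rho>' * b (x $ 1) / (2 * \<rho> (x $ 1))) * X x $ 1 + k * a (x $ 1) / (2 * \<rho> (x $ 1)) * X x $ 2]"
proof -
  have "frechet_derivative V (at x) = frechet_derivative (rotational_field a b) (at x)"
    by (rule frechet_derivative_cong_open[OF open_half_plane]) (use assms in auto)
  also have "\<dots> = (\<lambda>h. vector [a' * h $ 1, b' * h $ 1])"
    unfolding rotational_field_def[abs_def]
    by (intro frechet_derivative_eqI has_derivative_vector_2 has_derivative_of_first assms)
  finally have D: "frechet_derivative V (at x) = \<dots>" .
  have "rot_map \<rho> k x $ 1 = \<rho> (x $ 1)"
    by (simp add: rot_map_def)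
  then show ?thesis
    using pos
    by (simp add: nabla_along_def D differential_rot_map[OF assms(5)] christoffel_target
        assms(1)[OF assms(2)] rotational_field_def vec_eq_iff forall_2 field_simps)
qed

text \<open>This is the Laplacian of the flat plane on functions of the radius.\<close>

definition radial_laplacian :: "(real \<Rightarrow> real) \<Rightarrow> real \<Rightarrow> real" where
  "radial_laplacian f r = deriv (deriv f) r + deriv f r / r"

text \<open>The radial component of the tension field.\<close>

definition radial_tension :: "real \<Rightarrow> (real \<Rightarrow> real) \<Rightarrow> real \<Rightarrow> real" where
  "radial_tension k \<rho> r = (1 + r\<^sup>2)\<^sup>2 / 4 * (radial_laplacian \<rho> r - k\<^sup>2 / (2 * r\<^sup>2))"

lemma smooth_radial_tension:
  assumes "smooth_on {0<..} \<rho>"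
  shows "smooth_on {0<..} (radial_tension k \<rho>)"
proof -
  note d1 = smooth_on_deriv(2)[OF open_greaterThan assms]
  note d2 = smooth_on_deriv(2)[OF open_greaterThan d1]
  have "Ck_on n {0<..} (\<lambda>r. (1 + r * r) * (1 + r * r) * (1 / 4) *
      (deriv (deriv \<rho>) r + deriv \<rho> r * inverse r + - (k\<^sup>2 / 2) * (inverse r * inverse r)))" for n
    using d1 d2 unfolding smooth_on_def
    by (intro Ck_on_add Ck_on_mult Ck_on_inverse Ck_on_ident Ck_on_const) auto
  moreover have "(1 + r * r) * (1 + r * r) * (1 / 4) *
      (deriv (deriv \<rho>) r + deriv \<rho> r * inverse r + - (k\<^sup>2 / 2) * (inverse r * inverse r))
      = radial_tension k \<rho> r" for r
  proof -
    have 1: "k\<^sup>2 / (2 * r\<^sup>2) = k\<^sup>2 / 2 * (inverse r * inverse r)"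
      by (simp only: divide_inverse power2_eq_square inverse_mult_distrib mult.assoc)
    have 2: "(1 + r\<^sup>2)\<^sup>2 / 4 = (1 + r * r) * (1 + r * r) * (1 / 4)"
      by (simp add: power2_eq_square)
    show ?thesis
      unfolding radial_tension_def radial_laplacian_def 1 2
      by (simp only: divide_inverse[of "deriv \<rho> r"] diff_conv_add_uminus mult_minus_left)
  qed
  ultimately show ?thesis by (simp add: smooth_on_def)
qed

context
  fixes k :: real and \<rho> :: "real \<Rightarrow> real"
  assumes smooth: "smooth_on {0<..} \<rho>" and pos: "\<And>r. 0 < r \<Longrightarrow> 0 < \<rho> r"
begin

lemma deriv_profile:
  assumes "0 < r"
  shows "(\<rho> has_real_derivative deriv \<rho> r) (at r)"
    and "(deriv \<rho> has_real_derivative deriv (deriv \<rho>) r) (at r)"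
  using smooth_on_deriv[OF open_greaterThan smooth]
    smooth_on_deriv(1)[OF open_greaterThan smooth_on_deriv(2)[OF open_greaterThan smooth]] assms
  by auto

text \<open>The first-order terms of the two Christoffel contributions of the sphere add up to
  \<open>\<rho>' / r\<close>, as for the flat plane, since the metrics are conformal in dimension two; only
  the conformal factor of the trace remains.\<close>

lemma tension_field_rot_map:
  assumes "0 < x $ 1"
  shows "tension_field sphere_metric target_metric (rot_map \<rho> k) x =
    rotational_field (radial_tension k \<rho>) (\<lambda>_. 0) x"
proof -
  define r where "r = x $ 1"
  have r: "0 < r" using assms by (simp add: r_def)
  note nz = one_plus_square_nonzero[of r]
  note d = deriv_profile[of "x $ 1", OF assms]
  have V1: "differential (rot_map \<rho> k) (coord_field 1) y = rotational_field (deriv \<rho>) (\<lambda>_. 0) y"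
    and V2: "differential (rot_map \<rho> k) (coord_field 2) y = rotational_field (\<lambda>_. 0) (\<lambda>_. k) y"
    if "0 < y $ 1" for y
    using differential_rot_map[OF deriv_profile(1)[OF that]]
    by (simp_all add: rotational_field_def coord_field_def axis_def)
  have N1: "nabla_along target_metric (rot_map \<rho> k) (coord_field 1)
      (differential (rot_map \<rho> k) (coord_field 1)) x = vector [deriv (deriv \<rho>) r, 0]"
    by (subst nabla_along_rotational_field[OF V1 assms d(2) DERIV_const d(1) pos[OF assms]])
      (simp_all add: coord_field_def axis_def r_def)
  have N2: "nabla_along target_metric (rot_map \<rho> k) (coord_field 2)
      (differential (rot_map \<rho> k) (coord_field 2)) x = vector [- k\<^sup>2 / 2, 0]"
    by (subst nabla_along_rotational_field[OF V2 assms DERIV_const DERIV_const d(1) pos[OF assms]])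
      (simp_all add: coord_field_def axis_def power2_eq_square)
  have "tension_field sphere_metric target_metric (rot_map \<rho> k) x =
      ((1 + r\<^sup>2)\<^sup>2 / 4) *\<^sub>R ((vector [deriv (deriv \<rho>) r, 0]
        - vector [deriv \<rho> r * (- 2 * r / (1 + r\<^sup>2)), 0]) +
      (1 / r\<^sup>2) *\<^sub>R (vector [- k\<^sup>2 / 2, 0]
        - vector [deriv \<rho> r * (- r * (1 - r\<^sup>2) / (1 + r\<^sup>2)), 0]))"
    by (simp add: tension_field_def metric_trace_sphere[OF assms] r_def N1[unfolded r_def] N2
        nabla_sphere_coord[OF assms] differential_rot_map[OF d(1)])
  also have "\<dots> = vector [radial_tension k \<rho> r, 0]"
    using r nz
    by (simp add: vector_2_arith vector_2_eq_iff radial_tension_def radial_laplacian_def divide_simps) algebra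
  finally show ?thesis by (simp add: rotational_field_def r_def)
qed

text \<open>Turning in the angular direction twice, \<open>\<partial>\<^sub>\<rho>\<close> comes back multiplied by \<open>- k\<^sup>2 / (4 \<rho>)\<close>; the
  curvature term in the same direction is equal to this, and it is subtracted.\<close>

lemma bitension_field_rot_map:
  assumes "0 < x $ 1"
  shows "bitension_field sphere_metric target_metric (rot_map \<rho> k) x =
    vector [(1 + (x $ 1)\<^sup>2)\<^sup>2 / 4 * radial_laplacian (radial_tension k \<rho>) (x $ 1), 0]"
proof -
  define r where "r = x $ 1"
  define T where "T = radial_tension k \<rho>"
  let ?\<tau> = "tension_field sphere_metric target_metric (rot_map \<rho> k)"
  let ?D = "nabla_along target_metric (rot_map \<rho> k)"
  have r: "0 < r" and \<rho>r: "0 < \<rho> r" using assms pos by (simp_all add: r_def)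
  note nz = one_plus_square_nonzero[of r]
  have T: "smooth_on {0<..} T"
    unfolding T_def by (rule smooth_radial_tension[OF smooth])
  have dT: "(T has_real_derivative deriv T s) (at s)"
    "(deriv T has_real_derivative deriv (deriv T) s) (at s)" if "0 < s" for s
    using smooth_on_deriv[OF open_greaterThan T]
      smooth_on_deriv(1)[OF open_greaterThan smooth_on_deriv(2)[OF open_greaterThan T]] that by auto
  have \<tau>: "?\<tau> y = rotational_field T (\<lambda>_. 0) y" if "0 < y $ 1" for y
    unfolding T_def by (rule tension_field_rot_map[OF that])
  have D: "?D X ?\<tau> y = vector
      [deriv T (y $ 1) * X y $ 1, k * T (y $ 1) / (2 * \<rho> (y $ 1)) * X y $ 2]" if "0 < y $ 1" for X y
    by (subst nabla_along_rotational_field[OF \<tau> that dT(1)[OF that] DERIV_const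
          deriv_profile(1)[OF that] pos[OF that]]) simp_all
  have D1: "?D (coord_field 1) ?\<tau> y = rotational_field (deriv T) (\<lambda>_. 0) y"
    and D2: "?D (coord_field 2) ?\<tau> y = rotational_field (\<lambda>_. 0) (\<lambda>s. k * T s / (2 * \<rho> s)) y"
    if "0 < y $ 1" for y
    using that by (simp_all add: D rotational_field_def coord_field_def axis_def)
  have DD1: "?D (coord_field 1) (?D (coord_field 1) ?\<tau>) x = vector [deriv (deriv T) r, 0]"
    by (subst nabla_along_rotational_field[OF D1 assms dT(2)[OF assms] DERIV_const
          deriv_profile(1)[OF assms] pos[OF assms]])
      (simp_all add: coord_field_def axis_def r_def)
  have "2 * \<rho> r \<noteq> 0" using \<rho>r by simp
  from DERIV_divide[OF DERIV_cmult[OF dT(1)[OF r], of k] DERIV_cmult[OF deriv_profile(1)[OF r], of 2] this]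
  \<comment> \<open>Along the angular direction the \<open>r\<close>-derivative \<open>c\<close> is multiplied by zero, so it is left abstract.\<close>
  obtain c where c: "((\<lambda>s. k * T s / (2 * \<rho> s)) has_real_derivative c) (at (x $ 1))"
    unfolding r_def ..
  have DD2: "?D (coord_field 2) (?D (coord_field 2) ?\<tau>) x = vector [- k\<^sup>2 * T r / (4 * \<rho> r), 0]"
    by (subst nabla_along_rotational_field[OF D2 assms DERIV_const c
          deriv_profile(1)[OF assms] pos[OF assms]])
      (simp_all add: coord_field_def axis_def r_def power2_eq_square mult.assoc)
  have \<rho>x: "rot_map \<rho> k x $ 1 = \<rho> r"
    by (simp add: rot_map_def r_def)
  have R1: "curvature target_metric (rot_map \<rho> k x)
      (differential (rot_map \<rho> k) (coord_field 1) x) (?\<tau> x)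
      (differential (rot_map \<rho> k) (coord_field 1) x) = 0"
    and R2: "curvature target_metric (rot_map \<rho> k x)
      (differential (rot_map \<rho> k) (coord_field 2) x) (?\<tau> x)
      (differential (rot_map \<rho> k) (coord_field 2) x) = vector [- k\<^sup>2 * T r / (4 * \<rho> r), 0]"
    using \<rho>r
    by (simp_all add: curvature_target \<rho>x differential_rot_map[OF deriv_profile(1)[OF assms]]
        \<tau>[OF assms] rotational_field_def coord_field_def axis_def r_def vec_eq_iff forall_2
        field_simps power2_eq_square)
  have "bitension_field sphere_metric target_metric (rot_map \<rho> k) x =
      ((1 + r\<^sup>2)\<^sup>2 / 4) *\<^sub>R ((vector [deriv (deriv T) r, 0]
        - vector [deriv T r * (- 2 * r / (1 + r\<^sup>2)), 0]) +
      (1 / r\<^sup>2) *\<^sub>R (vector [- k\<^sup>2 * T r / (4 * \<rho> r), 0]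
        - vector [deriv T r * (- r * (1 - r\<^sup>2) / (1 + r\<^sup>2)), 0])) -
      ((1 + r\<^sup>2)\<^sup>2 / 4) *\<^sub>R ((1 / r\<^sup>2) *\<^sub>R vector [- k\<^sup>2 * T r / (4 * \<rho> r), 0])"
    by (simp add: bitension_field_def metric_trace_sphere[OF assms] DD1 DD2 R1 R2 D[OF assms]
        nabla_sphere_coord[OF assms] flip: r_def)
  \<comment> \<open>The curvature trace cancels the zeroth-order term of the rough Laplacian.\<close>
  also have "\<dots> = vector [(1 + r\<^sup>2)\<^sup>2 / 4 * radial_laplacian T r, 0]"
    using r nz \<rho>r
    by (simp add: vector_2_arith vector_2_eq_iff radial_laplacian_def divide_simps) algebra
  finally show ?thesis by (simp add: T_def r_def)
qed

lemma biharmonic_rot_map_iff: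
  assumes "\<Theta> \<noteq> {}"
  shows "biharmonic_map (punctured_sphere \<Theta>) sphere_metric target_surface target_metric (rot_map \<rho> k)
    \<longleftrightarrow> (\<forall>r>0. radial_laplacian (radial_tension k \<rho>) r = 0)"
proof -
  obtain \<theta> where \<theta>: "\<theta> \<in> \<Theta>" using assms by auto
  have "smooth_map (punctured_sphere \<Theta>) target_surface (rot_map \<rho> k)"
    unfolding smooth_map_def smooth_on_def
  proof
    show "\<forall>n. Ck_on n (punctured_sphere \<Theta>) (rot_map \<rho> k)"
      using smooth_rot_map[OF smooth, of k] unfolding smooth_on_def
      by (auto intro: Ck_on_subset simp: punctured_sphere_def)
    show "rot_map \<rho> k ` punctured_sphere \<Theta> \<subseteq> target_surface"
      by (auto simp: punctured_sphere_def target_surface_def rot_map_def pos)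
  qed
  moreover have "bitension_field sphere_metric target_metric (rot_map \<rho> k) x = 0
      \<longleftrightarrow> radial_laplacian (radial_tension k \<rho>) (x $ 1) = 0" if "x \<in> punctured_sphere \<Theta>" for x
    using that one_plus_square_nonzero[of "x $ 1"]
    by (simp add: punctured_sphere_def bitension_field_rot_map vector_2_arith vector_2_eq_iff)
  moreover have "vector [r, \<theta>] \<in> punctured_sphere \<Theta>" if "0 < r" for r
    using that \<theta> by (simp add: punctured_sphere_def)
  ultimately show ?thesis
    unfolding biharmonic_map_def
    by (metis (mono_tags, lifting) mem_Collect_eq punctured_sphere_def vector_2(1))
qed

end

section \<open>Solving the radial equations\<close>

lemma radial_laplacian_eqI:
  assumes "\<And>s. 0 < s \<Longrightarrow> (f has_real_derivative f' s) (at s)"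
    and "\<And>s. 0 < s \<Longrightarrow> (f' has_real_derivative f'' s) (at s)" and "0 < r"
  shows "radial_laplacian f r = f'' r + f' r / r"
proof -
  have d: "deriv f s = f' s" if "0 < s" for s
    using assms(1)[OF that] by (rule DERIV_imp_deriv)
  have "(deriv f has_real_derivative f'' r) (at r)"
    by (rule DERIV_cong_ev[THEN iffD2, OF refl _ refl assms(2)[OF assms(3)]])
      (use eventually_nhds_in_open[of "{0<..}" r] assms(3) d in \<open>auto elim: eventually_mono\<close>)
  then show ?thesis
    using d[OF assms(3)] by (simp add: radial_laplacian_def DERIV_imp_deriv)
qed

text \<open>The equation is \<open>(r f')' = 0\<close>. The lemma is used twice: for the tension, and for the difference
  of two profiles with the same tension.\<close>

lemma radially_harmonic_imp_log:
  assumes "\<And>s. 0 < s \<Longrightarrow> (f has_real_derivative f' s) (at s)"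
    and "\<And>s. 0 < s \<Longrightarrow> (f' has_real_derivative f'' s) (at s)"
    and "\<And>s. 0 < s \<Longrightarrow> f'' s + f' s / s = 0"
  shows "\<exists>A B. \<forall>r>0. f r = A + B * ln r"
proof -
  have "((\<lambda>s. s * f' s) has_real_derivative 0) (at s within {0<..})" if "s \<in> {0<..}" for s
  proof -
    have "1 * f' s + f'' s * s = 0"
      using assms(3)[of s] that by (simp add: field_simps)
    then show ?thesis
      using DERIV_mult[OF DERIV_ident assms(2)[of s]] that
      by (auto intro!: has_field_derivative_at_within)
  qed
  then obtain B where B: "s * f' s = B" if "0 < s" for s
    using has_field_derivative_zero_constant[of "{0<..}" "\<lambda>s. s * f' s"] by auto
  have "((\<lambda>s. f s - B * ln s) has_real_derivative 0) (at s within {0<..})" if "s \<in> {0<..}" for s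
  proof -
    have "((\<lambda>s. f s - B * ln s) has_real_derivative f' s - B * (1 / s)) (at s)"
      using assms(1)[of s] that by (auto intro!: derivative_eq_intros)
    then show ?thesis
      using B[of s] that by (auto intro!: has_field_derivative_at_within simp: field_simps)
  qed
  then obtain A where "f s - B * ln s = A" if "0 < s" for s
    using has_field_derivative_zero_constant[of "{0<..}" "\<lambda>s. f s - B * ln s"] by auto
  then show ?thesis by (intro exI[of _ A] exI[of _ B]) (auto simp: algebra_simps)
qed

definition biharmonic_profile ::
    "real \<Rightarrow> (real \<Rightarrow> real) \<Rightarrow> real \<Rightarrow> real \<Rightarrow> real \<Rightarrow> real \<Rightarrow> real \<Rightarrow> real" where
  "biharmonic_profile k F A B C D r = A + B * ln r + C * ln (1 + r\<^sup>2) + D * ln r * ln (1 + r\<^sup>2)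
    - 2 * D * F r + k\<^sup>2 / 4 * (ln r)\<^sup>2"

definition biharmonic_profile_deriv :: "real \<Rightarrow> real \<Rightarrow> real \<Rightarrow> real \<Rightarrow> real \<Rightarrow> real" where
  "biharmonic_profile_deriv k B C D r = (B + k\<^sup>2 / 2 * ln r - D * ln (1 + r\<^sup>2)) / r
    + (C + D * ln r) * (2 * r / (1 + r\<^sup>2))"

definition biharmonic_profile_deriv2 :: "real \<Rightarrow> real \<Rightarrow> real \<Rightarrow> real \<Rightarrow> real \<Rightarrow> real" where
  "biharmonic_profile_deriv2 k B C D r = (k\<^sup>2 / 2 - (B + k\<^sup>2 / 2 * ln r - D * ln (1 + r\<^sup>2))) / r\<^sup>2
    + (C + D * ln r) * (2 * (1 - r\<^sup>2) / (1 + r\<^sup>2)\<^sup>2)"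

text \<open>The term \<open>- 2 D F\<close> cancels the first-order part that the product rule leaves behind: in the
  variable \<open>s = ln r\<close>, \<open>(s L - 2 \<integral> L ds)'' = s L''\<close> for \<open>L = ln (1 + r\<^sup>2)\<close>, whose
  second \<open>s\<close>-derivative \<open>4 r\<^sup>2 / (1 + r\<^sup>2)\<^sup>2\<close> is the conformal factor of the sphere.\<close>

lemma biharmonic_profile_derivs:
  fixes F :: "real \<Rightarrow> real"
  assumes F: "\<And>r. 0 < r \<Longrightarrow> (F has_real_derivative ln (1 + r\<^sup>2) / r) (at r)" and r: "0 < r"
  shows "(biharmonic_profile k F A B C D has_real_derivative biharmonic_profile_deriv k B C D r) (at r)"
    and "(biharmonic_profile_deriv k B C D has_real_derivative biharmonic_profile_deriv2 k B C D r) (at r)"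
    and "biharmonic_profile_deriv2 k B C D r + biharmonic_profile_deriv k B C D r / r =
      k\<^sup>2 / (2 * r\<^sup>2) + 4 / (1 + r\<^sup>2)\<^sup>2 * (C + D * ln r)"
proof -
  have p: "0 < 1 + r\<^sup>2" using r by (simp add: add_pos_pos)
  note nz = one_plus_square_nonzero[of r]
  have ln1p: "((\<lambda>r. ln (1 + r\<^sup>2)) has_real_derivative 2 * r / (1 + r\<^sup>2)) (at r)"
    using p by (auto intro!: derivative_eq_intros)
  have ln_square: "((\<lambda>r. (ln r)\<^sup>2) has_real_derivative 2 * ln r / r) (at r)"
    using r by (auto intro!: derivative_eq_intros)
  have quotient: "((\<lambda>r. 2 * r / (1 + r\<^sup>2)) has_real_derivative 2 * (1 - r\<^sup>2) / (1 + r\<^sup>2)\<^sup>2) (at r)"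
    using nz by (auto intro!: derivative_eq_intros simp: divide_simps) algebra
  have rne: "r \<noteq> 0" using r by simp
  show "(biharmonic_profile k F A B C D has_real_derivative biharmonic_profile_deriv k B C D r) (at r)"
    unfolding biharmonic_profile_def[abs_def] biharmonic_profile_deriv_def
    by (rule DERIV_cong[OF DERIV_add[OF DERIV_diff[OF DERIV_add[OF DERIV_add[OF DERIV_add[OF
            DERIV_const DERIV_cmult[OF DERIV_ln_divide[OF r]]] DERIV_cmult[OF ln1p]]
            DERIV_mult[OF DERIV_cmult[OF DERIV_ln_divide[OF r]] ln1p]] DERIV_cmult[OF F[OF r]]]
            DERIV_cmult[OF ln_square]]])
      (use r nz in \<open>simp add: divide_simps; algebra\<close>)
  show "(biharmonic_profile_deriv k B C D has_real_derivative biharmonic_profile_deriv2 k B C D r) (at r)"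
    unfolding biharmonic_profile_deriv2_def biharmonic_profile_deriv_def[abs_def]
    by (rule DERIV_cong[OF DERIV_add[OF DERIV_divide[OF DERIV_diff[OF DERIV_add[OF
            DERIV_const DERIV_cmult[OF DERIV_ln_divide[OF r]]] DERIV_cmult[OF ln1p]] DERIV_ident rne]
            DERIV_mult[OF DERIV_add[OF DERIV_const DERIV_cmult[OF DERIV_ln_divide[OF r]]] quotient]]])
      (use r nz in \<open>simp add: divide_simps; algebra\<close>)
  show "biharmonic_profile_deriv2 k B C D r + biharmonic_profile_deriv k B C D r / r =
      k\<^sup>2 / (2 * r\<^sup>2) + 4 / (1 + r\<^sup>2)\<^sup>2 * (C + D * ln r)"
    unfolding biharmonic_profile_deriv2_def biharmonic_profile_deriv_def using r nz
    by (simp add: divide_simps) algebra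
qed

lemma antiderivative_ln1p_square:
  "\<exists>F. \<forall>r>0. (F has_real_derivative ln (1 + r\<^sup>2) / r) (at r)"
proof -
  have "\<exists>F. \<forall>r::real. 0 < ereal r \<longrightarrow> ereal r < \<infinity> \<longrightarrow>
      (F has_vector_derivative ln (1 + r\<^sup>2) / r) (at r)"
    by (rule einterval_antiderivative)
      (auto intro!: continuous_intros simp: one_plus_square_nonzero)
  then show ?thesis by (auto simp: has_real_derivative_iff_has_vector_derivative)
qed

lemma radial_tension_biharmonic_profile:
  fixes F :: "real \<Rightarrow> real"
  assumes F: "\<And>r. 0 < r \<Longrightarrow> (F has_real_derivative ln (1 + r\<^sup>2) / r) (at r)"
    and \<rho>: "\<And>r. 0 < r \<Longrightarrow> \<rho> r = biharmonic_profile k F A B C D r"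
    and r: "0 < r"
  shows "radial_tension k \<rho> r = C + D * ln r"
proof -
  note d = biharmonic_profile_derivs[OF F, where k = k and B = B and C = C and D = D]
  have d1: "(\<rho> has_real_derivative biharmonic_profile_deriv k B C D s) (at s)" if "0 < s" for s
    by (rule has_field_derivative_transform_within_open[OF d(1)[OF _ that] open_greaterThan[of 0]])
      (use that \<rho> in auto)
  have "radial_laplacian \<rho> r = k\<^sup>2 / (2 * r\<^sup>2) + 4 / (1 + r\<^sup>2)\<^sup>2 * (C + D * ln r)"
    using radial_laplacian_eqI[OF d1 d(2) r] d(3)[OF _ r] by simp
  then show ?thesis
    using one_plus_square_nonzero[of r] by (simp add: radial_tension_def)
qed

lemma radial_tension_log_iff:
  assumes smooth: "smooth_on {0<..} \<rho>"
  shows "(\<forall>r>0. radial_laplacian (radial_tension k \<rho>) r = 0) \<longleftrightarrow>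
    (\<exists>C3 C4. \<forall>r>0. radial_tension k \<rho> r = C3 + C4 * ln r)"
proof
  let ?T = "radial_tension k \<rho>"
  have T: "smooth_on {0<..} ?T" by (rule smooth_radial_tension[OF smooth])
  assume "\<forall>r>0. radial_laplacian ?T r = 0"
  then show "\<exists>C3 C4. \<forall>r>0. ?T r = C3 + C4 * ln r"
    using smooth_on_deriv[OF open_greaterThan T]
      smooth_on_deriv(1)[OF open_greaterThan smooth_on_deriv(2)[OF open_greaterThan T]]
    by (intro radially_harmonic_imp_log[where f' = "deriv ?T" and f'' = "deriv (deriv ?T)"])
      (auto simp: radial_laplacian_def)
next
  let ?T = "radial_tension k \<rho>"
  assume "\<exists>C3 C4. \<forall>r>0. ?T r = C3 + C4 * ln r"
  then obtain C3 C4 where T: "\<And>r. 0 < r \<Longrightarrow> ?T r = C3 + C4 * ln r" by auto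
  show "\<forall>r>0. radial_laplacian ?T r = 0"
  proof (intro allI impI)
    fix r :: real assume "0 < r"
    have "(?T has_real_derivative C4 / s) (at s)" if "0 < s" for s
      by (rule has_field_derivative_transform_within_open[of "\<lambda>s. C3 + C4 * ln s" _ _ "{0<..}"])
        (use that T in \<open>auto intro!: derivative_eq_intros\<close>)
    moreover have "((\<lambda>s. C4 / s) has_real_derivative - C4 / s\<^sup>2) (at s)" if "0 < s" for s
      using that by (auto intro!: derivative_eq_intros simp: power2_eq_square)
    ultimately show "radial_laplacian ?T r = 0"
      using radial_laplacian_eqI[of ?T "\<lambda>s. C4 / s" "\<lambda>s. - C4 / s\<^sup>2", OF _ _ \<open>0 < r\<close>]
      by (simp add: power2_eq_square)
  qed
qed

text \<open>Prescribing the tension prescribes the Laplacian of \<open>\<rho>\<close>, so \<open>\<rho>\<close> and the particular profile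
  with \<open>A = B = 0\<close> differ by a radially harmonic function.\<close>

lemma biharmonic_profile_if_radial_tension_log:
  assumes smooth: "smooth_on {0<..} \<rho>"
    and T: "\<And>r. 0 < r \<Longrightarrow> radial_tension k \<rho> r = C + D * ln r"
    and F: "\<And>r. 0 < r \<Longrightarrow> (F has_real_derivative ln (1 + r\<^sup>2) / r) (at r)"
  shows "\<exists>A B. \<forall>r>0. \<rho> r = biharmonic_profile k F A B C D r"
proof -
  note d = biharmonic_profile_derivs[OF F, where k = k and C = C and D = D]
  note s1 = smooth_on_deriv(1)[OF open_greaterThan smooth]
  note s2 = smooth_on_deriv(1)[OF open_greaterThan smooth_on_deriv(2)[OF open_greaterThan smooth]]
  have L: "radial_laplacian \<rho> r = k\<^sup>2 / (2 * r\<^sup>2) + 4 / (1 + r\<^sup>2)\<^sup>2 * (C + D * ln r)"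
    if "0 < r" for r
    using T[OF that] one_plus_square_nonzero[of r]
    by (simp add: radial_tension_def field_simps)
  have "\<exists>A B. \<forall>r>0. \<rho> r - biharmonic_profile k F 0 0 C D r = A + B * ln r"
  proof (rule radially_harmonic_imp_log)
    fix s :: real assume s: "0 < s"
    show "((\<lambda>r. \<rho> r - biharmonic_profile k F 0 0 C D r) has_real_derivative
        deriv \<rho> s - biharmonic_profile_deriv k 0 C D s) (at s)"
      by (rule DERIV_diff[OF s1 d(1)[OF _ s]]) (use s in auto)
    show "((\<lambda>s. deriv \<rho> s - biharmonic_profile_deriv k 0 C D s) has_real_derivative
        deriv (deriv \<rho>) s - biharmonic_profile_deriv2 k 0 C D s) (at s)"
      by (rule DERIV_diff[OF s2 d(2)[OF _ s]]) (use s in auto)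
    show "deriv (deriv \<rho>) s - biharmonic_profile_deriv2 k 0 C D s +
        (deriv \<rho> s - biharmonic_profile_deriv k 0 C D s) / s = 0"
      using L[OF s] d(3)[OF _ s, of 0] unfolding radial_laplacian_def diff_divide_distrib by linarith
  qed
  then obtain A B where "\<And>r. 0 < r \<Longrightarrow> \<rho> r - biharmonic_profile k F 0 0 C D r = A + B * ln r"
    by blast
  then show ?thesis
    by (intro exI[of _ A] exI[of _ B]) (auto simp: biharmonic_profile_def algebra_simps)
qed

section \<open>Biharmonic rotationally symmetric maps\<close>

theorem theorem2p10:
  fixes k :: real and \<Theta> :: "real set"
  assumes "open \<Theta>" and "\<Theta> \<noteq> {}"
  shows "(\<forall>\<rho> :: real \<Rightarrow> real. smooth_on {0<..} \<rho> \<longrightarrow> (\<forall>r>0. 0 < \<rho> r) \<longrightarrow>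
      (biharmonic_map (punctured_sphere \<Theta>) sphere_metric target_surface target_metric (rot_map \<rho> k)
       \<longleftrightarrow>
       (\<exists>C1 C2 C3 C4 :: real. \<exists>F :: real \<Rightarrow> real.
          (\<forall>r>0. (F has_real_derivative ln (1 + r\<^sup>2) / r) (at r)) \<and>
          (\<forall>r>0. \<rho> r = C1 + (C2 - 2 * C3) * ln r + C3 * ln (1 + r\<^sup>2)
                       + C4 * ln r * ln (1 + r\<^sup>2) - 2 * C4 * F r + k\<^sup>2 / 4 * (ln r)\<^sup>2))))
    \<and> proper_biharmonic_map (punctured_sphere \<Theta>) sphere_metric target_surface target_metric
        (rot_map (\<lambda>r. k\<^sup>2 / 4 * (ln r)\<^sup>2 + ln (1 + r\<^sup>2)) k)"
proof
  obtain F0 where F0: "\<And>r. 0 < r \<Longrightarrow> (F0 has_real_derivative ln (1 + r\<^sup>2) / r) (at r)"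
    using antiderivative_ln1p_square by auto
  show "\<forall>\<rho> :: real \<Rightarrow> real. smooth_on {0<..} \<rho> \<longrightarrow> (\<forall>r>0. 0 < \<rho> r) \<longrightarrow>
      (biharmonic_map (punctured_sphere \<Theta>) sphere_metric target_surface target_metric (rot_map \<rho> k)
       \<longleftrightarrow>
       (\<exists>C1 C2 C3 C4 :: real. \<exists>F :: real \<Rightarrow> real.
          (\<forall>r>0. (F has_real_derivative ln (1 + r\<^sup>2) / r) (at r)) \<and>
          (\<forall>r>0. \<rho> r = C1 + (C2 - 2 * C3) * ln r + C3 * ln (1 + r\<^sup>2)
                       + C4 * ln r * ln (1 + r\<^sup>2) - 2 * C4 * F r + k\<^sup>2 / 4 * (ln r)\<^sup>2)))"
    (is "\<forall>\<rho>. _ \<longrightarrow> _ \<longrightarrow> (_ \<longleftrightarrow> ?formula \<rho>)")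
  proof (intro allI impI)
    fix \<rho> :: "real \<Rightarrow> real"
    assume smooth: "smooth_on {0<..} \<rho>" and pos: "\<forall>r>0. 0 < \<rho> r"
    have "biharmonic_map (punctured_sphere \<Theta>) sphere_metric target_surface target_metric (rot_map \<rho> k)
        \<longleftrightarrow> (\<exists>C3 C4. \<forall>r>0. radial_tension k \<rho> r = C3 + C4 * ln r)"
      using biharmonic_rot_map_iff[OF smooth _ assms(2)] pos radial_tension_log_iff[OF smooth] by simp
    also have "\<dots> \<longleftrightarrow> ?formula \<rho>"
    proof
      assume "\<exists>C3 C4. \<forall>r>0. radial_tension k \<rho> r = C3 + C4 * ln r"
      then obtain C3 C4 where "\<And>r. 0 < r \<Longrightarrow> radial_tension k \<rho> r = C3 + C4 * ln r" by auto
      then obtain A B where \<rho>: "\<forall>r>0. \<rho> r = biharmonic_profile k F0 A B C3 C4 r"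
        using biharmonic_profile_if_radial_tension_log[OF smooth _ F0] by blast
      \<comment> \<open>The coefficient of \<open>ln r\<close> is written as \<open>C2 - 2 * C3\<close> in the formula.\<close>
      show "?formula \<rho>"
        by (rule exI[of _ A], rule exI[of _ "B + 2 * C3"], rule exI[of _ C3], rule exI[of _ C4],
            rule exI[of _ F0]) (use \<rho> F0 in \<open>auto simp: biharmonic_profile_def\<close>)
    next
      assume "?formula \<rho>"
      then obtain C1 C2 C3 C4 F where
        "\<And>r. 0 < r \<Longrightarrow> (F has_real_derivative ln (1 + r\<^sup>2) / r) (at r)"
        "\<And>r. 0 < r \<Longrightarrow> \<rho> r = biharmonic_profile k F C1 (C2 - 2 * C3) C3 C4 r"
        unfolding biharmonic_profile_def by blast
      from radial_tension_biharmonic_profile[OF this]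
      show "\<exists>C3 C4. \<forall>r>0. radial_tension k \<rho> r = C3 + C4 * ln r" by blast
    qed
    finally show "biharmonic_map (punctured_sphere \<Theta>) sphere_metric target_surface target_metric
        (rot_map \<rho> k) \<longleftrightarrow> ?formula \<rho>" .
  qed
  define \<rho> where "\<rho> = (\<lambda>r. k\<^sup>2 / 4 * (ln r)\<^sup>2 + ln (1 + r\<^sup>2))"
  have smooth: "smooth_on {0<..} \<rho>"
    unfolding \<rho>_def by (rule smooth_on_ln_ln1p)
  have pos: "0 < \<rho> r" if "0 < r" for r
    unfolding \<rho>_def using that by (intro add_nonneg_pos) (auto simp: ln_gt_zero)
  have T: "radial_tension k \<rho> r = 1" if "0 < r" for r
    using radial_tension_biharmonic_profile[OF F0, of \<rho> k 0 0 1 0, OF _ _ that]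
    by (simp add: \<rho>_def biharmonic_profile_def)
  have "biharmonic_map (punctured_sphere \<Theta>) sphere_metric target_surface target_metric (rot_map \<rho> k)"
    using biharmonic_rot_map_iff[OF smooth pos assms(2)] radial_tension_log_iff[OF smooth, of k] T
    by (metis add.right_neutral mult_zero_left)
  moreover have "\<not> harmonic_map (punctured_sphere \<Theta>) sphere_metric target_surface target_metric (rot_map \<rho> k)"
  proof -
    obtain \<theta> where \<theta>: "\<theta> \<in> \<Theta>" using assms(2) by auto
    let ?x = "vector [1, \<theta>] :: real^2"
    have "?x \<in> punctured_sphere \<Theta>"
      using \<theta> by (simp add: punctured_sphere_def)
    moreover have "tension_field sphere_metric target_metric (rot_map \<rho> k) ?x \<noteq> 0"
      by (simp add: tension_field_rot_map[OF smooth pos] rotational_field_def T vector_2_arith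
          vector_2_eq_iff)
    ultimately show ?thesis unfolding harmonic_map_def by blast
  qed
  ultimately show "proper_biharmonic_map (punctured_sphere \<Theta>) sphere_metric target_surface target_metric
      (rot_map (\<lambda>r. k\<^sup>2 / 4 * (ln r)\<^sup>2 + ln (1 + r\<^sup>2)) k)"
    unfolding proper_biharmonic_map_def \<rho>_def by blast
qed

end
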